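(* Let $A^d,A^c\in\mathbb R^{n_x\times n_x}$, $B^d,B^c\in\mathbb R^{n_x\times n_w}$, $C^d,C^c\in\mathbb R^{n_z\times n_x}$, $D^d,D^c\in\mathbb R^{n_z\times n_w}$. Fix a symmetric $Q\in\mathbb R^{n_x\times n_x}$ with $Q\succ0$ and symmetric matrices $Z_i\in\mathbb R^{n_w\times n_w}$, $i\in\{1,\dots,N\}$. For $p\in[0,1]$ and a real variable $\lambda_i$, let $M_p(\lambda_i)$ be any one of the following three expressions: (a) $M_p(\lambda_i)=(A^d+p\lambda_iA^c)^TQ(A^d+p\lambda_iA^c)-Q+2p(1-p)\lambda_iA^{cT}QA^c$; (b) $M_p(\lambda_i)=(A^d+p\lambda_iA^c)^TQ(A^d+p\lambda_iA^c)+(C^d+p\lambda_iC^c)^T(C^d+p\lambda_iC^c)-Q+2p(1-p)\lambda_i\big(A^{cT}QA^c+C^{cT}C^c\big)$; (c) $M_p(\lambda_i)=(B^d+p\lambda_iB^c)^TQ(B^d+p\lambda_iB^c)+(D^d+p\lambda_iD^c)^T(D^d+p\lambda_iD^c)-Z_i+2p(1-p)\lambda_i\big(B^{cT}QB^c+D^{cT}D^c\big)$. Define $V_p(\lambda_i,y)=y^TM_p(\lambda_i)y$. Then $V_p(\lambda_i,y)$ is convex in $\lambda_i$ (for every vector $y$) for all $p\in[0,1]$.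
   Context: $Q\succ0$ means symmetric positive definite; $A^{cT}=(A^c)^T$ and similarly for the other matrices. The matrices $Q$ and $Z_i$ are held fixed as $\lambda_i$ varies. *)

theory Defs
  imports "HOL-Analysis.Analysis"
begin

text \<open>
  A real matrix with \<open>m\<close> rows and \<open>n\<close> columns has type \<open>real ^ 'n ^ 'm\<close>.
  The index types \<open>'x\<close>, \<open>'w\<close>, \<open>'z\<close> stand for the dimensions
  \<open>n\<^sub>x\<close>, \<open>n\<^sub>w\<close>, \<open>n\<^sub>z\<close>.
\<close>

definition symmetric_matrix :: "real ^ 'n ^ 'n \<Rightarrow> bool" where
  "symmetric_matrix Q \<longleftrightarrow> transpose Q = Q"

definition positive_definite :: "real ^ 'n ^ 'n \<Rightarrow> bool" where
  "positive_definite Q \<longleftrightarrow> symmetric_matrix Q \<and> (\<forall>v. v \<noteq> 0 \<longrightarrow> 0 < v \<bullet> (Q *v v))"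

definition M_a ::
  "real ^ 'x ^ 'x \<Rightarrow> real ^ 'x ^ 'x \<Rightarrow> real ^ 'x ^ 'x \<Rightarrow> real \<Rightarrow> real \<Rightarrow> real ^ 'x ^ 'x" where
  "M_a Ad Ac Q p l =
     transpose (Ad + (p * l) *\<^sub>R Ac) ** Q ** (Ad + (p * l) *\<^sub>R Ac)
     - Q
     + (2 * p * (1 - p) * l) *\<^sub>R (transpose Ac ** Q ** Ac)"

definition M_b ::
  "real ^ 'x ^ 'x \<Rightarrow> real ^ 'x ^ 'x \<Rightarrow> real ^ 'x ^ 'z \<Rightarrow> real ^ 'x ^ 'z \<Rightarrow> real ^ 'x ^ 'x
    \<Rightarrow> real \<Rightarrow> real \<Rightarrow> real ^ 'x ^ 'x" where
  "M_b Ad Ac Cd Cc Q p l =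
     transpose (Ad + (p * l) *\<^sub>R Ac) ** Q ** (Ad + (p * l) *\<^sub>R Ac)
     + transpose (Cd + (p * l) *\<^sub>R Cc) ** (Cd + (p * l) *\<^sub>R Cc)
     - Q
     + (2 * p * (1 - p) * l) *\<^sub>R (transpose Ac ** Q ** Ac + transpose Cc ** Cc)"

definition M_c ::
  "real ^ 'w ^ 'x \<Rightarrow> real ^ 'w ^ 'x \<Rightarrow> real ^ 'w ^ 'z \<Rightarrow> real ^ 'w ^ 'z \<Rightarrow> real ^ 'x ^ 'x
    \<Rightarrow> real ^ 'w ^ 'w \<Rightarrow> real \<Rightarrow> real \<Rightarrow> real ^ 'w ^ 'w" where
  "M_c Bd Bc Dd Dc Q Zi p l =
     transpose (Bd + (p * l) *\<^sub>R Bc) ** Q ** (Bd + (p * l) *\<^sub>R Bc)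
     + transpose (Dd + (p * l) *\<^sub>R Dc) ** (Dd + (p * l) *\<^sub>R Dc)
     - Zi
     + (2 * p * (1 - p) * l) *\<^sub>R (transpose Bc ** Q ** Bc + transpose Dc ** Dc)"

text \<open>\<open>V M l y\<close> is \<open>y\<^sup>T M(l) y\<close> for a matrix-valued function \<open>M\<close> of one real variable.\<close>

definition V :: "(real \<Rightarrow> real ^ 'n ^ 'n) \<Rightarrow> real \<Rightarrow> real ^ 'n \<Rightarrow> real" where
  "V M l y = y \<bullet> (M l *v y)"

end

theory Submission
  imports Defs
begin

text \<open>
  Along a line, the quadratic form of a positive semidefinite matrix is a quadratic
  polynomial with nonnegative leading coefficient. All remaining terms of
  \<open>V\<close> are affine in \<open>\<lambda>\<^sub>i\<close>, so they do not affect convexity.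
\<close>

lemma convex_on_quadratic:
  fixes a b c :: real
  assumes "0 \<le> a"
  shows "convex_on UNIV (\<lambda>t. a * t\<^sup>2 + b * t + c)"
  by (rule f''_ge0_imp_convex[where f' = "\<lambda>t. 2 * a * t + b" and f'' = "\<lambda>t. 2 * a"])
     (auto intro!: derivative_eq_intros simp: assms)

text \<open>Moving \<open>transpose A\<close> across the inner product leaves the form of
  \<open>P\<close> at \<open>A *v y\<close>. With \<open>A\<close> affine in the real variable, the
  dependence on that variable then sits in a vector moving along a line.\<close>

lemma inner_congruence:
  fixes P :: "real ^ 'm ^ 'm" and A :: "real ^ 'n ^ 'm"
  shows "y \<bullet> ((transpose A ** P ** A) *v y) = (A *v y) \<bullet> (P *v (A *v y))"
  by (metis dot_lmul_matrix inner_commute matrix_vector_mul_assoc transpose_matrix_vector)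

lemma inner_gram:
  fixes A :: "real ^ 'n ^ 'm"
  shows "y \<bullet> ((transpose A ** A) *v y) = (A *v y) \<bullet> (A *v y)"
  using inner_congruence[of y A "mat 1"] by simp

lemma quadratic_form_line:
  fixes P :: "real ^ 'm ^ 'm"
  shows "(u + s *\<^sub>R v) \<bullet> (P *v (u + s *\<^sub>R v)) =
    (v \<bullet> (P *v v)) * s\<^sup>2 + (u \<bullet> (P *v v) + v \<bullet> (P *v u)) * s + u \<bullet> (P *v u)"
  by (simp add: matrix_vector_right_distrib matrix_vector_mult_scaleR inner_simps
      power2_eq_square algebra_simps)

text \<open>As a polynomial in \<open>l\<close>, the form has leading coefficient
  \<open>(v \<bullet> (P *v v)) * p\<^sup>2\<close>, a product of two nonnegative numbers.\<close>

lemma convex_on_quadratic_form_line: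
  fixes P :: "real ^ 'm ^ 'm"
  assumes "\<And>v. 0 \<le> v \<bullet> (P *v v)"
  shows "convex_on UNIV (\<lambda>l. (u + (p * l) *\<^sub>R v) \<bullet> (P *v (u + (p * l) *\<^sub>R v)))"
proof -
  have "convex_on UNIV (\<lambda>l. ((v \<bullet> (P *v v)) * p\<^sup>2) * l\<^sup>2 
      + ((u \<bullet> (P *v v) + v \<bullet> (P *v u)) * p) * l + u \<bullet> (P *v u))"
    using assms by (intro convex_on_quadratic) simp
  then show ?thesis
    by (simp add: quadratic_form_line power_mult_distrib mult.assoc)
qed

lemma convex_on_inner_line:
  fixes u v :: "real ^ 'm"
  shows "convex_on UNIV (\<lambda>l. (u + (p * l) *\<^sub>R v) \<bullet> (u + (p * l) *\<^sub>R v))"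
  using convex_on_quadratic_form_line[of "mat 1" u p v] by simp

lemma convex_on_affine:
  fixes b c :: real
  shows "convex_on UNIV (\<lambda>t. b * t + c)"
  using convex_on_quadratic[of 0 b c] by simp

lemma positive_definite_nonneg:
  "positive_definite Q \<Longrightarrow> 0 \<le> v \<bullet> (Q *v v)"
  by (cases "v = 0") (auto simp: positive_definite_def less_imp_le)

text \<open>These rules distribute \<open>y \<bullet> (M *v y)\<close> over the summands of
  \<open>M\<close>, pull scalars out of the matrices, and reduce each product to a form at an image
  of \<open>y\<close>.\<close>

lemmas quadratic_form_simps =
  matrix_vector_mult_add_rdistrib matrix_vector_mult_diff_rdistrib
  scaleR_matrix_vector_assoc[symmetric] inner_add_right inner_diff_right
  inner_congruence inner_gram

lemma convex_on_V_M_a: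
  assumes "positive_definite Q"
  shows "convex_on UNIV (\<lambda>l. V (M_a Ad Ac Q p) l y)"
proof -
  let ?u = "Ad *v y" and ?v = "Ac *v y"
  \<comment> \<open>The last bracket has the shape \<open>b * l + c\<close>, with \<open>- Q\<close>
    supplying the constant, so that \<open>convex_on_affine\<close> applies to it directly.\<close>
  have "V (M_a Ad Ac Q p) l y =
      (?u + (p * l) *\<^sub>R ?v) \<bullet> (Q *v (?u + (p * l) *\<^sub>R ?v))
      + ((2 * p * (1 - p) * (?v \<bullet> (Q *v ?v))) * l + - (y \<bullet> (Q *v y)))" for l
    by (simp add: V_def M_a_def quadratic_form_simps)
  then show ?thesis
    by (simp only:) (intro convex_on_add convex_on_quadratic_form_line convex_on_affine
      positive_definite_nonneg assms)
qed

text \<open>The matrix \<open>S\<close> enters only the constant term of the polynomial in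
  \<open>l\<close>; keeping it arbitrary covers both \<open>Z i\<close> and
  \<open>Q\<close>.\<close>

lemma convex_on_V_M_c:
  assumes "positive_definite Q"
  shows "convex_on UNIV (\<lambda>l. V (M_c Bd Bc Dd Dc Q S p) l y)"
proof -
  let ?u = "Bd *v y" and ?v = "Bc *v y" and ?r = "Dd *v y" and ?s = "Dc *v y"
  have "V (M_c Bd Bc Dd Dc Q S p) l y =
      (?u + (p * l) *\<^sub>R ?v) \<bullet> (Q *v (?u + (p * l) *\<^sub>R ?v))
      + (?r + (p * l) *\<^sub>R ?s) \<bullet> (?r + (p * l) *\<^sub>R ?s)
      + ((2 * p * (1 - p) * (?v \<bullet> (Q *v ?v) + ?s \<bullet> ?s)) * l + - (y \<bullet> (S *v y)))" for l
    by (simp add: V_def M_c_def quadratic_form_simps)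
  then show ?thesis
    by (simp only:) (intro convex_on_add convex_on_quadratic_form_line convex_on_inner_line
      convex_on_affine positive_definite_nonneg assms)
qed

text \<open>Case (b) is the instance of case (c) with equal state and input index types and
  \<open>Q\<close> as the subtracted matrix.\<close>

lemma M_b_eq_M_c: "M_b Ad Ac Cd Cc Q = M_c Ad Ac Cd Cc Q Q"
  by (simp add: M_b_def M_c_def fun_eq_iff)

theorem lemma9:
  fixes Ad Ac :: "real ^ 'x ^ 'x"
    and Bd Bc :: "real ^ 'w ^ 'x"
    and Cd Cc :: "real ^ 'x ^ 'z"
    and Dd Dc :: "real ^ 'w ^ 'z"
    and Q :: "real ^ 'x ^ 'x"
    and Z :: "nat \<Rightarrow> real ^ 'w ^ 'w"
    and N :: nat
    and p :: real
  assumes "positive_definite Q"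
    and "\<And>i. i \<in> {1..N} \<Longrightarrow> symmetric_matrix (Z i)"
    and "p \<in> {0..1}"
  shows "(\<forall>y. convex_on UNIV (\<lambda>l. V (M_a Ad Ac Q p) l y))
    \<and> (\<forall>y. convex_on UNIV (\<lambda>l. V (M_b Ad Ac Cd Cc Q p) l y))
    \<and> (\<forall>i\<in>{1..N}. \<forall>y. convex_on UNIV (\<lambda>l. V (M_c Bd Bc Dd Dc Q (Z i) p) l y))"
  using assms(1) by (simp add: M_b_eq_M_c convex_on_V_M_a convex_on_V_M_c)

end
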